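(* For any essentially small triangulated category $\mathsf{K}$ there exists a sober space $\mathrm{Spcnt}\,\mathsf{K}$ (the one defined in the context) such that if $\mathrm{Thick}(\mathsf{K})$ is distributive then $\mathcal{O}\,\mathrm{Spcnt}\,\mathsf{K}$, the lattice of open subsets of $\mathrm{Spcnt}\,\mathsf{K}$, is isomorphic to $\mathrm{Thick}(\mathsf{K})$. This space comes with a canonical continuous comparison map $\mathrm{Spcnt}\,\mathsf{K}\to\mathrm{fSpcnt}\,\mathsf{K}$, namely the inclusion of the set of maps $\mathrm{Thick}(\mathsf{K})\to\mathbf{2}$ preserving finite meets and arbitrary joins into the set of maps $\mathrm{Thick}(\mathsf{K})\to\mathbf{2}$ preserving arbitrary joins.
   Context: A thick subcategory of a triangulated category is a full subcategory closed under isomorphisms, suspensions, cones and direct summands. $\mathrm{Thick}(\mathsf{K})$ is the complete lattice of thick subcategories of $\mathsf{K}$ ordered by inclusion; meets are intersections, and the join of a family is the smallest thick subcategory containing its union. Let $\mathbf{2}=\{0\le 1\}$ and $L=\mathrm{Thick}(\mathsf{K})$. $\mathrm{Spcnt}\,\mathsf{K}$ is (canonically homeomorphic to) the set of poset maps $p\colon L\to\mathbf{2}$ preserving arbitrary joins and finite meets (hence top and bottom), with open subsets $\{p\mid p(l)=1\}$ for $l\in L$. Equivalently it is the set of meet-prime thick subcategories. $\mathrm{fSpcnt}\,\mathsf{K}$ is (canonically homeomorphic to) the set of poset maps $p\colon L\to\mathbf{2}$ preserving arbitrary joins (including the bottom, but not necessarily finite meets), with the topology generated by the subbase of open subsets $\{p\mid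 p(l)=1\}$ for $l\in L$. *)

theory Defs
  imports
    "HOL-Analysis.Abstract_Topology"
    "HOL-Algebra.Group"
    "HOL-Algebra.Complete_Lattice"
begin

section \<open>Triangulated categories\<close>

text \<open>
  The objects and the morphisms of a category are sets over HOL types, so every category below is
  small. An essentially small category is equivalent to a small one, and thick subcategories are
  closed under isomorphisms, so the lattice of thick subcategories does not see the difference.
\<close>

record ('o, 'm) category_data =
  Obj :: "'o set"
  Arr :: "'m set"
  source :: "'m \<Rightarrow> 'o"
  target :: "'m \<Rightarrow> 'o"
  ident :: "'o \<Rightarrow> 'm"
  compose :: "'m \<Rightarrow> 'm \<Rightarrow> 'm"  (infixr \<open>\<cdot>\<index>\<close> 75)

definition Hom :: "('o, 'm, 'x) category_data_scheme \<Rightarrow> 'o \<Rightarrow> 'o \<Rightarrow> 'm set" where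
  "Hom K x y = {f \<in> Arr K. source K f = x \<and> target K f = y}"

locale category =
  fixes K :: "('o, 'm, 'x) category_data_scheme" (structure)
  assumes source_Obj: "f \<in> Arr K \<Longrightarrow> source K f \<in> Obj K"
    and target_Obj: "f \<in> Arr K \<Longrightarrow> target K f \<in> Obj K"
    and ident_Hom: "x \<in> Obj K \<Longrightarrow> ident K x \<in> Hom K x x"
    and compose_Hom: "f \<in> Hom K x y \<Longrightarrow> g \<in> Hom K y z \<Longrightarrow> g \<cdot> f \<in> Hom K x z"
    and compose_ident: "f \<in> Hom K x y \<Longrightarrow> f \<cdot> ident K x = f"
    and ident_compose: "f \<in> Hom K x y \<Longrightarrow> ident K y \<cdot> f = f"
    and compose_assoc: "f \<in> Hom K w x \<Longrightarrow> g \<in> Hom K x y \<Longrightarrow> h \<in> Hom K y z \<Longrightarrow>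
      (h \<cdot> g) \<cdot> f = h \<cdot> (g \<cdot> f)"

definition is_iso :: "('o, 'm, 'x) category_data_scheme \<Rightarrow> 'o \<Rightarrow> 'o \<Rightarrow> 'm \<Rightarrow> bool" where
  "is_iso K x y f \<longleftrightarrow> f \<in> Hom K x y \<and>
     (\<exists>g \<in> Hom K y x. g \<cdot>\<^bsub>K\<^esub> f = ident K x \<and> f \<cdot>\<^bsub>K\<^esub> g = ident K y)"

definition isomorphic :: "('o, 'm, 'x) category_data_scheme \<Rightarrow> 'o \<Rightarrow> 'o \<Rightarrow> bool" where
  "isomorphic K x y \<longleftrightarrow> (\<exists>f. is_iso K x y f)"

definition is_zero_object :: "('o, 'm, 'x) category_data_scheme \<Rightarrow> 'o \<Rightarrow> bool" where
  "is_zero_object K z \<longleftrightarrow> z \<in> Obj K \<and>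
     (\<forall>x \<in> Obj K. (\<exists>!f. f \<in> Hom K z x) \<and> (\<exists>!f. f \<in> Hom K x z))"

definition is_endofunctor ::
  "('o, 'm, 'x) category_data_scheme \<Rightarrow> ('o \<Rightarrow> 'o) \<Rightarrow> ('m \<Rightarrow> 'm) \<Rightarrow> bool" where
  "is_endofunctor K F\<^sub>o F\<^sub>m \<longleftrightarrow>
     (\<forall>x \<in> Obj K. F\<^sub>o x \<in> Obj K) \<and>
     (\<forall>x y. \<forall>f \<in> Hom K x y. F\<^sub>m f \<in> Hom K (F\<^sub>o x) (F\<^sub>o y)) \<and>
     (\<forall>x \<in> Obj K. F\<^sub>m (ident K x) = ident K (F\<^sub>o x)) \<and>
     (\<forall>x y z. \<forall>f \<in> Hom K x y. \<forall>g \<in> Hom K y z. F\<^sub>m (g \<cdot>\<^bsub>K\<^esub> f) = F\<^sub>m g \<cdot>\<^bsub>K\<^esub> F\<^sub>m f)"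

definition naturally_isomorphic ::
  "('o, 'm, 'x) category_data_scheme \<Rightarrow> ('o \<Rightarrow> 'o) \<Rightarrow> ('m \<Rightarrow> 'm) \<Rightarrow> ('o \<Rightarrow> 'o) \<Rightarrow> ('m \<Rightarrow> 'm) \<Rightarrow> bool"
  where
  "naturally_isomorphic K F\<^sub>o F\<^sub>m G\<^sub>o G\<^sub>m \<longleftrightarrow>
     (\<exists>\<eta>. (\<forall>x \<in> Obj K. is_iso K (F\<^sub>o x) (G\<^sub>o x) (\<eta> x)) \<and>
          (\<forall>x y. \<forall>f \<in> Hom K x y. G\<^sub>m f \<cdot>\<^bsub>K\<^esub> \<eta> x = \<eta> y \<cdot>\<^bsub>K\<^esub> F\<^sub>m f))"

definition is_autoequivalence ::
  "('o, 'm, 'x) category_data_scheme \<Rightarrow> ('o \<Rightarrow> 'o) \<Rightarrow> ('m \<Rightarrow> 'm) \<Rightarrow> bool" where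
  "is_autoequivalence K F\<^sub>o F\<^sub>m \<longleftrightarrow> is_endofunctor K F\<^sub>o F\<^sub>m \<and>
     (\<exists>G\<^sub>o G\<^sub>m. is_endofunctor K G\<^sub>o G\<^sub>m \<and>
        naturally_isomorphic K (G\<^sub>o \<circ> F\<^sub>o) (G\<^sub>m \<circ> F\<^sub>m) id id \<and>
        naturally_isomorphic K (F\<^sub>o \<circ> G\<^sub>o) (F\<^sub>m \<circ> G\<^sub>m) id id)"

record ('o, 'm) triangulated_data = "('o, 'm) category_data" +
  plus :: "'m \<Rightarrow> 'm \<Rightarrow> 'm"  (infixl \<open>\<boxplus>\<index>\<close> 65)
  zero_arr :: "'o \<Rightarrow> 'o \<Rightarrow> 'm"
  susp_obj :: "'o \<Rightarrow> 'o"
  susp_arr :: "'m \<Rightarrow> 'm"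
  triangles :: "('m \<times> 'm \<times> 'm) set"

definition Hom_group :: "('o, 'm, 'x) triangulated_data_scheme \<Rightarrow> 'o \<Rightarrow> 'o \<Rightarrow> 'm monoid" where
  "Hom_group K x y = \<lparr>carrier = Hom K x y, monoid.mult = plus K, one = zero_arr K x y\<rparr>"

locale preadditive_category = category K
  for K :: "('o, 'm, 'x) triangulated_data_scheme" (structure) +
  assumes Hom_comm_group: "x \<in> Obj K \<Longrightarrow> y \<in> Obj K \<Longrightarrow> comm_group (Hom_group K x y)"
    and compose_plus: "f \<in> Hom K x y \<Longrightarrow> f' \<in> Hom K x y \<Longrightarrow> g \<in> Hom K y z \<Longrightarrow>
      g \<cdot> (f \<boxplus> f') = (g \<cdot> f) \<boxplus> (g \<cdot> f')"
    and plus_compose: "f \<in> Hom K x y \<Longrightarrow> g \<in> Hom K y z \<Longrightarrow> g' \<in> Hom K y z \<Longrightarrow>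
      (g \<boxplus> g') \<cdot> f = (g \<cdot> f) \<boxplus> (g' \<cdot> f)"

definition is_direct_sum :: "('o, 'm, 'x) triangulated_data_scheme \<Rightarrow> 'o \<Rightarrow> 'o \<Rightarrow> 'o \<Rightarrow> bool" where
  "is_direct_sum K x y s \<longleftrightarrow>
     (\<exists>i \<in> Hom K x s. \<exists>j \<in> Hom K y s. \<exists>p \<in> Hom K s x. \<exists>q \<in> Hom K s y.
        p \<cdot>\<^bsub>K\<^esub> i = ident K x \<and> q \<cdot>\<^bsub>K\<^esub> j = ident K y \<and>
        p \<cdot>\<^bsub>K\<^esub> j = zero_arr K y x \<and> q \<cdot>\<^bsub>K\<^esub> i = zero_arr K x y \<and>
        (i \<cdot>\<^bsub>K\<^esub> p) \<boxplus>\<^bsub>K\<^esub> (j \<cdot>\<^bsub>K\<^esub> q) = ident K s)"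

locale additive_category = preadditive_category K
  for K :: "('o, 'm, 'x) triangulated_data_scheme" (structure) +
  assumes zero_object: "\<exists>z. is_zero_object K z"
    and direct_sums: "x \<in> Obj K \<Longrightarrow> y \<in> Obj K \<Longrightarrow> \<exists>s \<in> Obj K. is_direct_sum K x y s"

text \<open>Candidate triangles \<open>x \<rightarrow> y \<rightarrow> z \<rightarrow> \<Sigma>x\<close>, not required to be distinguished.\<close>

definition is_triangle ::
  "('o, 'm, 'x) triangulated_data_scheme \<Rightarrow> 'o \<Rightarrow> 'o \<Rightarrow> 'o \<Rightarrow> 'm \<times> 'm \<times> 'm \<Rightarrow> bool" where
  "is_triangle K x y z t \<longleftrightarrow>
     (case t of (f, g, h) \<Rightarrow> f \<in> Hom K x y \<and> g \<in> Hom K y z \<and> h \<in> Hom K z (susp_obj K x))"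

definition dist_triangle ::
  "('o, 'm, 'x) triangulated_data_scheme \<Rightarrow> 'o \<Rightarrow> 'o \<Rightarrow> 'o \<Rightarrow> 'm \<times> 'm \<times> 'm \<Rightarrow> bool" where
  "dist_triangle K x y z t \<longleftrightarrow> is_triangle K x y z t \<and> t \<in> triangles K"

text \<open>The three squares of a morphism \<open>(a, b, c)\<close> of triangles commute.\<close>

definition triangle_squares ::
  "('o, 'm, 'x) triangulated_data_scheme \<Rightarrow> 'm \<times> 'm \<times> 'm \<Rightarrow> 'm \<times> 'm \<times> 'm \<Rightarrow> 'm \<Rightarrow> 'm \<Rightarrow> 'm \<Rightarrow> bool"
  where
  "triangle_squares K t t' a b c \<longleftrightarrow>
     (case t of (f, g, h) \<Rightarrow> case t' of (f', g', h') \<Rightarrow>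
        b \<cdot>\<^bsub>K\<^esub> f = f' \<cdot>\<^bsub>K\<^esub> a \<and> c \<cdot>\<^bsub>K\<^esub> g = g' \<cdot>\<^bsub>K\<^esub> b \<and> susp_arr K a \<cdot>\<^bsub>K\<^esub> h = h' \<cdot>\<^bsub>K\<^esub> c)"

locale triangulated_category = additive_category K
  for K :: "('o, 'm, 'x) triangulated_data_scheme" (structure) +
  assumes susp_autoequivalence: "is_autoequivalence K (susp_obj K) (susp_arr K)"
    and susp_plus: "f \<in> Hom K x y \<Longrightarrow> f' \<in> Hom K x y \<Longrightarrow>
      susp_arr K (f \<boxplus> f') = susp_arr K f \<boxplus> susp_arr K f'"
    and triangles_typed: "t \<in> triangles K \<Longrightarrow> \<exists>x y z. is_triangle K x y z t"
    and TR1_iso: "dist_triangle K x y z t \<Longrightarrow> is_triangle K x' y' z' t' \<Longrightarrow>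
      is_iso K x x' a \<Longrightarrow> is_iso K y y' b \<Longrightarrow> is_iso K z z' c \<Longrightarrow>
      triangle_squares K t t' a b c \<Longrightarrow> dist_triangle K x' y' z' t'"
    and TR1_ident: "x \<in> Obj K \<Longrightarrow> is_zero_object K z \<Longrightarrow>
      dist_triangle K x x z (ident K x, zero_arr K x z, zero_arr K z (susp_obj K x))"
    and TR1_cone: "f \<in> Hom K x y \<Longrightarrow> \<exists>z g h. dist_triangle K x y z (f, g, h)"
    and TR2: "is_triangle K x y z (f, g, h) \<Longrightarrow>
      dist_triangle K x y z (f, g, h) \<longleftrightarrow>
      dist_triangle K y z (susp_obj K x)
        (g, h, inv\<^bsub>Hom_group K (susp_obj K x) (susp_obj K y)\<^esub> (susp_arr K f))"
    and TR3: "dist_triangle K x y z (f, g, h) \<Longrightarrow> dist_triangle K x' y' z' (f', g', h') \<Longrightarrow>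
      a \<in> Hom K x x' \<Longrightarrow> b \<in> Hom K y y' \<Longrightarrow> b \<cdot> f = f' \<cdot> a \<Longrightarrow>
      \<exists>c \<in> Hom K z z'. triangle_squares K (f, g, h) (f', g', h') a b c"
    and TR4: "dist_triangle K x y u (f, f\<^sub>1, f\<^sub>2) \<Longrightarrow> dist_triangle K y z w (g, g\<^sub>1, g\<^sub>2) \<Longrightarrow>
      dist_triangle K x z v (g \<cdot> f, k\<^sub>1, k\<^sub>2) \<Longrightarrow>
      \<exists>a \<in> Hom K u v. \<exists>b \<in> Hom K v w.
        dist_triangle K u v w (a, b, susp_arr K f\<^sub>1 \<cdot> g\<^sub>2) \<and>
        triangle_squares K (f, f\<^sub>1, f\<^sub>2) (g \<cdot> f, k\<^sub>1, k\<^sub>2) (ident K x) g a \<and>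
        triangle_squares K (g \<cdot> f, k\<^sub>1, k\<^sub>2) (g, g\<^sub>1, g\<^sub>2) f (ident K z) b"

section \<open>The lattice of thick subcategories\<close>

text \<open>
  A full subcategory is given by its set of objects. Thick subcategories are triangulated
  subcategories, so they contain the zero objects and are closed under all powers of the
  suspension; given closure under isomorphisms, closure under desuspension says that \<open>x\<close>
  belongs to the subcategory as soon as \<open>\<Sigma>x\<close> does.
\<close>

definition thick :: "('o, 'm, 'x) triangulated_data_scheme \<Rightarrow> 'o set \<Rightarrow> bool" where
  "thick K S \<longleftrightarrow> S \<subseteq> Obj K \<and>
     (\<forall>z. is_zero_object K z \<longrightarrow> z \<in> S) \<and>
     (\<forall>x \<in> S. \<forall>y \<in> Obj K. isomorphic K x y \<longrightarrow> y \<in> S) \<and>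
     (\<forall>x \<in> Obj K. x \<in> S \<longleftrightarrow> susp_obj K x \<in> S) \<and>
     (\<forall>x \<in> S. \<forall>y \<in> S. \<forall>z t. dist_triangle K x y z t \<longrightarrow> z \<in> S) \<and>
     (\<forall>s \<in> S. \<forall>x \<in> Obj K. \<forall>y \<in> Obj K. is_direct_sum K x y s \<longrightarrow> x \<in> S)"

definition Thick :: "('o, 'm, 'x) triangulated_data_scheme \<Rightarrow> 'o set gorder" where
  "Thick K = \<lparr>carrier = {S. thick K S}, eq = (=), le = (\<subseteq>)\<rparr>"

lemma thick_Obj:
  assumes "triangulated_category K"
  shows "thick K (Obj K)"
proof -
  interpret triangulated_category K by fact
  have "z \<in> Obj K" if "dist_triangle K x y z t" for x y z t
    using that target_Obj by (cases t) (auto simp: dist_triangle_def is_triangle_def Hom_def)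
  then show ?thesis
    using susp_autoequivalence
    by (auto simp: thick_def is_zero_object_def is_autoequivalence_def is_endofunctor_def)
qed

lemma thick_dest:
  assumes "thick K S"
  shows thick_subset: "S \<subseteq> Obj K"
    and thick_zero: "\<forall>z. is_zero_object K z \<longrightarrow> z \<in> S"
    and thick_iso: "\<forall>x \<in> S. \<forall>y \<in> Obj K. isomorphic K x y \<longrightarrow> y \<in> S"
    and thick_susp: "\<forall>x \<in> Obj K. x \<in> S \<longleftrightarrow> susp_obj K x \<in> S"
    and thick_cone: "\<forall>x \<in> S. \<forall>y \<in> S. \<forall>z t. dist_triangle K x y z t \<longrightarrow> z \<in> S"
    and thick_summand:
      "\<forall>s \<in> S. \<forall>x \<in> Obj K. \<forall>y \<in> Obj K. is_direct_sum K x y s \<longrightarrow> x \<in> S"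
  using assms by (unfold thick_def) (elim conjE, assumption)+

lemma thick_Inter:
  assumes thick: "\<And>S. S \<in> A \<Longrightarrow> thick K S" and "A \<noteq> {}"
  shows "thick K (\<Inter>A)"
  unfolding thick_def
proof (intro conjI allI ballI impI InterI)
  obtain S where "S \<in> A" using assms(2) by blast
  then show "\<Inter>A \<subseteq> Obj K" using thick_subset[OF thick] by blast
next
  fix z S assume "is_zero_object K z" and S: "S \<in> A"
  then show "z \<in> S" using thick_zero[OF thick[OF S]] by simp
next
  fix x y S assume "x \<in> \<Inter>A" "y \<in> Obj K" "isomorphic K x y" and S: "S \<in> A"
  then show "y \<in> S"
    using thick_iso[OF thick[OF S], THEN bspec, of x, THEN bspec, of y] by simp
next
  fix x assume "x \<in> Obj K"
  then have "x \<in> S \<longleftrightarrow> susp_obj K x \<in> S" if "S \<in> A" for S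
    using thick_susp[OF thick[OF that]] by simp
  then show "x \<in> \<Inter>A \<longleftrightarrow> susp_obj K x \<in> \<Inter>A" by simp
next
  fix x y z t S
  assume "x \<in> \<Inter>A" "y \<in> \<Inter>A" "dist_triangle K x y z t" and S: "S \<in> A"
  then show "z \<in> S"
    using thick_cone[OF thick[OF S], THEN bspec, of x, THEN bspec, of y, THEN spec, of z,
        THEN spec, of t] by simp
next
  fix s x y S
  assume "s \<in> \<Inter>A" "x \<in> Obj K" "y \<in> Obj K" "is_direct_sum K x y s" and S: "S \<in> A"
  then show "x \<in> S"
    using thick_summand[OF thick[OF S], THEN bspec, of s, THEN bspec, of x, THEN bspec, of y]
    by simp
qed

lemma partial_order_Thick: "partial_order (Thick K)"
  by unfold_locales (simp_all add: Thick_def)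

lemma is_lub_Thick:
  assumes "triangulated_category K" and "A \<subseteq> carrier (Thick K)"
  shows "is_lub (Thick K) (\<Inter>{T. thick K T \<and> \<Union>A \<subseteq> T}) A"
proof -
  have "\<Union>A \<subseteq> Obj K" using assms(2) thick_subset by (fastforce simp: Thick_def)
  then have "thick K (\<Inter>{T. thick K T \<and> \<Union>A \<subseteq> T})"
    using thick_Obj[OF assms(1)] by (intro thick_Inter) auto
  then show ?thesis
    using assms(2) by (simp add: least_def Upper_def Thick_def) blast
qed

lemma is_glb_Thick:
  assumes "triangulated_category K" and "A \<subseteq> carrier (Thick K)"
  shows "is_glb (Thick K) (if A = {} then Obj K else \<Inter>A) A"
proof (cases "A = {}")
  case True
  then show ?thesis
    using thick_Obj[OF assms(1)]
    by (auto simp: greatest_def Lower_def Thick_def dest: thick_subset)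
next
  case False
  then have "thick K (\<Inter>A)" using assms(2) by (intro thick_Inter) (auto simp: Thick_def)
  then show ?thesis
    using assms(2) False by (auto simp: greatest_def Lower_def Thick_def)
qed

lemma complete_lattice_Thick:
  assumes "triangulated_category K"
  shows "complete_lattice (Thick K)"
proof -
  interpret partial_order "Thick K" by (rule partial_order_Thick)
  show ?thesis
    by unfold_locales (use is_lub_Thick[OF assms] is_glb_Thick[OF assms] in blast)+
qed

lemma Sup_Thick:
  assumes "triangulated_category K" and "A \<subseteq> carrier (Thick K)"
  shows "\<Squnion>\<^bsub>Thick K\<^esub> A = \<Inter>{T. thick K T \<and> \<Union>A \<subseteq> T}"
proof -
  interpret partial_order "Thick K" by (rule partial_order_Thick)
  show ?thesis
    unfolding sup_def using is_lub_Thick[OF assms] least_unique by (intro some_equality) auto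
qed

lemma Inf_Thick:
  assumes "triangulated_category K" and "A \<subseteq> carrier (Thick K)"
  shows "\<Sqinter>\<^bsub>Thick K\<^esub> A = (if A = {} then Obj K else \<Inter>A)"
proof -
  interpret partial_order "Thick K" by (rule partial_order_Thick)
  show ?thesis
    unfolding inf_def using is_glb_Thick[OF assms] greatest_unique by (intro some_equality) auto
qed

definition distributive :: "('a, 'x) gorder_scheme \<Rightarrow> bool" where
  "distributive L \<longleftrightarrow> lattice L \<and>
     (\<forall>x \<in> carrier L. \<forall>y \<in> carrier L. \<forall>z \<in> carrier L.
        x \<sqinter>\<^bsub>L\<^esub> (y \<squnion>\<^bsub>L\<^esub> z) = (x \<sqinter>\<^bsub>L\<^esub> y) \<squnion>\<^bsub>L\<^esub> (x \<sqinter>\<^bsub>L\<^esub> z))"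

definition lattice_isomorphic :: "('a, 'x) gorder_scheme \<Rightarrow> ('b, 'y) gorder_scheme \<Rightarrow> bool" where
  "lattice_isomorphic L M \<longleftrightarrow>
     (\<exists>\<phi>. bij_betw \<phi> (carrier L) (carrier M) \<and> join_pres L M \<phi> \<and> meet_pres L M \<phi>)"

section \<open>The spaces of a complete lattice\<close>

definition two :: "bool gorder" where
  "two = \<lparr>carrier = UNIV, eq = (=), le = (\<le>)\<rparr>"

lemma Sup_two: "\<Squnion>\<^bsub>two\<^esub> B = (\<exists>b \<in> B. b)" and Inf_two: "\<Sqinter>\<^bsub>two\<^esub> B = (\<forall>b \<in> B. b)"
  and complete_lattice_two: "complete_lattice two"
proof -
  interpret partial_order two by unfold_locales (auto simp: two_def)
  have lub: "is_lub two (\<exists>b \<in> B. b) B" for B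
    by (auto simp: least_def Upper_def two_def)
  have glb: "is_glb two (\<forall>b \<in> B. b) B" for B
    by (auto simp: greatest_def Lower_def two_def)
  show "\<Squnion>\<^bsub>two\<^esub> B = (\<exists>b \<in> B. b)"
    unfolding sup_def using lub least_unique by (intro some_equality) auto
  show "\<Sqinter>\<^bsub>two\<^esub> B = (\<forall>b \<in> B. b)"
    unfolding inf_def using glb greatest_unique by (intro some_equality) auto
  show "complete_lattice two"
    by unfold_locales (use lub glb in blast)+
qed

definition finite_inf_pres ::
  "('a, 'x) gorder_scheme \<Rightarrow> ('b, 'y) gorder_scheme \<Rightarrow> ('a \<Rightarrow> 'b) \<Rightarrow> bool" where
  "finite_inf_pres L M p \<longleftrightarrow>
     (\<forall>A \<subseteq> carrier L. finite A \<longrightarrow> p (\<Sqinter>\<^bsub>L\<^esub> A) = \<Sqinter>\<^bsub>M\<^esub> (p ` A))"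

text \<open>Maps out of \<open>L\<close> are extensional functions, so that they are determined by their values on
  the carrier of \<open>L\<close>.\<close>

definition sup_maps :: "('a, 'x) gorder_scheme \<Rightarrow> ('a \<Rightarrow> bool) set" where
  "sup_maps L = {p \<in> carrier L \<rightarrow>\<^sub>E carrier two. isotone L two p \<and> sup_pres L two p}"

definition frame_maps :: "('a, 'x) gorder_scheme \<Rightarrow> ('a \<Rightarrow> bool) set" where
  "frame_maps L = {p \<in> sup_maps L. finite_inf_pres L two p}"

definition frame_map_space :: "('a, 'x) gorder_scheme \<Rightarrow> ('a \<Rightarrow> bool) topology" where
  "frame_map_space L = topology (\<lambda>U. \<exists>l \<in> carrier L. U = {p \<in> frame_maps L. p l})"

text \<open>The constant map \<open>False\<close> preserves joins but lies in no subbasic open set, so the underlying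
  set has to be given along with the subbase.\<close>

definition sup_map_space :: "('a, 'x) gorder_scheme \<Rightarrow> ('a \<Rightarrow> bool) topology" where
  "sup_map_space L = topology (arbitrary union_of
     (finite intersection_of (\<lambda>U. \<exists>l \<in> carrier L. U = {p \<in> sup_maps L. p l})
       relative_to sup_maps L))"

lemma frame_map_Sup: "p \<in> frame_maps L \<Longrightarrow> A \<subseteq> carrier L \<Longrightarrow> p (\<Squnion>\<^bsub>L\<^esub> A) = (\<exists>l \<in> A. p l)"
  by (simp add: frame_maps_def sup_maps_def sup_pres_def Sup_two)

lemma frame_map_Inf:
  "p \<in> frame_maps L \<Longrightarrow> A \<subseteq> carrier L \<Longrightarrow> finite A \<Longrightarrow> p (\<Sqinter>\<^bsub>L\<^esub> A) = (\<forall>l \<in> A. p l)"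
  by (simp add: frame_maps_def finite_inf_pres_def Inf_two)

lemma istopology_frame_maps:
  assumes "complete_lattice L"
  shows "istopology (\<lambda>U. \<exists>l \<in> carrier L. U = {p \<in> frame_maps L. p l})"
proof -
  interpret complete_lattice L by fact
  let ?open = "\<lambda>U. \<exists>l \<in> carrier L. U = {p \<in> frame_maps L. p l}"
  have "?open ({p \<in> frame_maps L. p l} \<inter> {p \<in> frame_maps L. p m})"
    if "l \<in> carrier L" "m \<in> carrier L" for l m
    by (rule bexI[of _ "\<Sqinter>\<^bsub>L\<^esub> {l, m}"]) (use that in \<open>auto simp: frame_map_Inf\<close>)
  moreover have "?open (\<Union>\<U>)" if "\<forall>U \<in> \<U>. ?open U" for \<U>
  proof -
    let ?A = "{l \<in> carrier L. {p \<in> frame_maps L. p l} \<in> \<U>}"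
    have "\<Union>\<U> = {p \<in> frame_maps L. \<exists>l \<in> ?A. p l}"
    proof (intro equalityI subsetI)
      fix p assume "p \<in> \<Union>\<U>"
      then obtain U where U: "U \<in> \<U>" "p \<in> U" by blast
      with that obtain l where "l \<in> carrier L" "U = {p \<in> frame_maps L. p l}" by blast
      with U show "p \<in> {p \<in> frame_maps L. \<exists>l \<in> ?A. p l}" by blast
    qed blast
    also have "\<dots> = {p \<in> frame_maps L. p (\<Squnion>\<^bsub>L\<^esub> ?A)}"
    proof (rule Collect_cong)
      fix p
      show "(p \<in> frame_maps L \<and> (\<exists>l \<in> ?A. p l)) = (p \<in> frame_maps L \<and> p (\<Squnion>\<^bsub>L\<^esub> ?A))"
        using frame_map_Sup[of p L ?A] by blast
    qed
    finally show ?thesis by (intro bexI[of _ "\<Squnion>\<^bsub>L\<^esub> ?A"]) auto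
  qed
  ultimately show ?thesis unfolding istopology_def by blast
qed

lemma openin_frame_map_space:
  assumes "complete_lattice L"
  shows "openin (frame_map_space L) U \<longleftrightarrow> (\<exists>l \<in> carrier L. U = {p \<in> frame_maps L. p l})"
  unfolding frame_map_space_def by (simp add: topology_inverse' istopology_frame_maps[OF assms])

lemma topspace_frame_map_space:
  assumes "complete_lattice L"
  shows "topspace (frame_map_space L) = frame_maps L"
proof -
  interpret complete_lattice L by fact
  have "frame_maps L = {p \<in> frame_maps L. p (\<Sqinter>\<^bsub>L\<^esub> {})}"
    using frame_map_Inf[of _ L "{}"] by auto
  then have "openin (frame_map_space L) (frame_maps L)"
    unfolding openin_frame_map_space[OF assms] by (intro bexI[of _ "\<Sqinter>\<^bsub>L\<^esub> {}"]) auto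
  moreover have "U \<subseteq> frame_maps L" if "openin (frame_map_space L) U" for U
    using that unfolding openin_frame_map_space[OF assms] by auto
  ultimately show ?thesis by (meson openin_subset openin_topspace subset_antisym)
qed

lemma topspace_sup_map_space: "topspace (sup_map_space L) = sup_maps L"
  by (simp add: sup_map_space_def)

definition Spcnt :: "('o, 'm, 'x) triangulated_data_scheme \<Rightarrow> ('o set \<Rightarrow> bool) topology" where
  "Spcnt K = frame_map_space (Thick K)"

definition fSpcnt :: "('o, 'm, 'x) triangulated_data_scheme \<Rightarrow> ('o set \<Rightarrow> bool) topology" where
  "fSpcnt K = sup_map_space (Thick K)"

section \<open>Sober spaces and lattices of open subsets\<close>

definition irreducible_closed_in :: "'a topology \<Rightarrow> 'a set \<Rightarrow> bool" where
  "irreducible_closed_in X C \<longleftrightarrow> closedin X C \<and> C \<noteq> {} \<and>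
     (\<forall>A B. closedin X A \<and> closedin X B \<and> C = A \<union> B \<longrightarrow> C = A \<or> C = B)"

definition sober_space :: "'a topology \<Rightarrow> bool" where
  "sober_space X \<longleftrightarrow>
     (\<forall>C. irreducible_closed_in X C \<longrightarrow> (\<exists>!x. x \<in> topspace X \<and> Abstract_Topology.closure_of X {x} = C))"

definition open_sets :: "'a topology \<Rightarrow> 'a set gorder" where
  "open_sets X = \<lparr>carrier = {U. openin X U}, eq = (=), le = (\<subseteq>)\<rparr>"

end

theory Submission
  imports Defs
begin

text \<open>
  Write \<open>L = Thick(K)\<close>. Sobriety holds for the space of frame maps of any complete lattice: an
  irreducible closed set \<open>C\<close> is the closure of the map sending \<open>l\<close> to \<open>1\<close> exactly if the open set of
  \<open>l\<close> meets \<open>C\<close>. That map preserves joins because a union meets \<open>C\<close> iff one of its members does, and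
  finite meets because finitely many open sets meeting an irreducible set have a common point in it
  (\<open>sober_frame_map_space\<close>).

  The map sending \<open>l\<close> to the open set \<open>{p | p(l) = 1}\<close> is always onto, so it is an isomorphism as
  soon as frame maps separate the elements of \<open>L\<close>
  (\<open>lattice_isomorphic_open_sets_frame_map_space\<close>). To separate thick subcategories \<open>A\<close> and \<open>B\<close>
  with \<open>A \<not>\<subseteq> B\<close>, choose an object \<open>x\<close> of \<open>A\<close> outside \<open>B\<close>. All closure conditions for thickness have
  finitely many objects as premises, so unions of chains of thick subcategories are thick, and Zorn's
  lemma yields a thick \<open>P\<close> that contains \<open>B\<close> and is maximal among those avoiding \<open>x\<close>. Every strictly
  larger thick subcategory contains the one generated by \<open>x\<close>; in a distributive lattice this makes
  \<open>P\<close> meet-prime (\<open>distributive_meet_prime\<close>), so that \<open>l \<mapsto> (l \<not>\<subseteq> P)\<close> is a frame map.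

  Continuity of the comparison map is immediate, since the subbasic open sets of \<open>fSpcnt K\<close> restrict
  to the open sets of \<open>Spcnt K\<close>.
\<close>

section \<open>Sobriety\<close>

lemma irreducible_closed_in_Int:
  assumes C: "irreducible_closed_in X C"
    and U: "openin X U" "C \<inter> U \<noteq> {}" and V: "openin X V" "C \<inter> V \<noteq> {}"
  shows "C \<inter> (U \<inter> V) \<noteq> {}"
proof
  assume "C \<inter> (U \<inter> V) = {}"
  then have "C = (C - U) \<union> (C - V)" by blast
  moreover have "closedin X (C - U)" "closedin X (C - V)"
    using C U V by (auto simp: irreducible_closed_in_def)
  ultimately have "C = C - U \<or> C = C - V"
    using C unfolding irreducible_closed_in_def by blast
  with U V show False by blast
qed

lemma frame_mapI:
  assumes L: "complete_lattice L" and ext: "p \<in> extensional (carrier L)"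
    and Sup: "\<And>A. A \<subseteq> carrier L \<Longrightarrow> p (\<Squnion>\<^bsub>L\<^esub> A) = (\<exists>l \<in> A. p l)"
    and Inf: "\<And>A. A \<subseteq> carrier L \<Longrightarrow> finite A \<Longrightarrow> p (\<Sqinter>\<^bsub>L\<^esub> A) = (\<forall>l \<in> A. p l)"
  shows "p \<in> frame_maps L"
proof -
  interpret complete_lattice L by fact
  interpret two: complete_lattice two by (rule complete_lattice_two)
  have "p l \<le> p m" if "l \<in> carrier L" "m \<in> carrier L" "l \<sqsubseteq>\<^bsub>L\<^esub> m" for l m
  proof -
    have "\<Squnion>\<^bsub>L\<^esub> {l, m} = m"
      using that by (intro le_antisym sup_least sup_upper) auto
    then show ?thesis using Sup[of "{l, m}"] that by auto
  qed
  then have "isotone L two p"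
    by (intro isotoneI weak_partial_order_axioms two.weak_partial_order_axioms) (auto simp: two_def)
  moreover have "sup_pres L two p"
    using Sup by (simp add: sup_pres_def L complete_lattice_two Sup_two)
  moreover have "finite_inf_pres L two p"
    using Inf by (simp add: finite_inf_pres_def Inf_two)
  moreover have "p \<in> carrier L \<rightarrow>\<^sub>E carrier two"
    using ext by (simp add: PiE_def two_def)
  ultimately show ?thesis by (simp add: frame_maps_def sup_maps_def)
qed

lemma frame_maps_eqI:
  assumes "p \<in> frame_maps L" "q \<in> frame_maps L" and eq: "\<And>l. l \<in> carrier L \<Longrightarrow> p l = q l"
  shows "p = q"
proof -
  have "p \<in> carrier L \<rightarrow>\<^sub>E carrier two" "q \<in> carrier L \<rightarrow>\<^sub>E carrier two"
    using assms(1,2) by (simp_all add: frame_maps_def sup_maps_def)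
  then show ?thesis using eq by (rule PiE_ext)
qed

text \<open>The points of the space are themselves lattice maps, so the generic point of an irreducible
  closed set can be written down as the map recording which open sets meet it.\<close>

lemma frame_map_of_irreducible_closed:
  assumes L: "complete_lattice L" and C: "irreducible_closed_in (frame_map_space L) C"
  shows "(\<lambda>l \<in> carrier L. \<exists>p \<in> C. p l) \<in> frame_maps L" (is "?q \<in> _")
proof (rule frame_mapI[OF L])
  interpret complete_lattice L by fact
  have C_sub: "C \<subseteq> frame_maps L"
    using C closedin_subset[of "frame_map_space L" C]
    by (simp add: irreducible_closed_in_def topspace_frame_map_space[OF L])
  have C_maps: "p \<in> frame_maps L" if "p \<in> C" for p using C_sub that by blast
  show "?q (\<Squnion>\<^bsub>L\<^esub> A) = (\<exists>l \<in> A. ?q l)" if A: "A \<subseteq> carrier L" for A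
  proof -
    have "?q (\<Squnion>\<^bsub>L\<^esub> A) = (\<exists>p \<in> C. \<exists>l \<in> A. p l)"
      using A frame_map_Sup[OF C_maps A] by simp
    also have "\<dots> = (\<exists>l \<in> A. ?q l)"
      using A by auto
    finally show ?thesis .
  qed
  have common: "\<exists>p \<in> C. \<forall>l \<in> A. p l"
    if "finite A" "A \<subseteq> carrier L" "\<forall>l \<in> A. \<exists>p \<in> C. p l" for A
    using that
  proof (induction A rule: finite_induct)
    case empty
    then show ?case using C by (auto simp: irreducible_closed_in_def)
  next
    case (insert l A)
    let ?U = "\<lambda>m. {p \<in> frame_maps L. p m}"
    have op: "openin (frame_map_space L) (?U m)" if "m \<in> carrier L" for m
      using that by (auto simp: openin_frame_map_space[OF L])
    have A: "\<Sqinter>\<^bsub>L\<^esub> A \<in> carrier L" using insert.prems by simp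
    have InfA: "p (\<Sqinter>\<^bsub>L\<^esub> A) = (\<forall>l \<in> A. p l)" if "p \<in> frame_maps L" for p
      using frame_map_Inf[OF that] insert by simp
    obtain p where "p \<in> C" "\<forall>l \<in> A. p l" using insert by auto
    then have "C \<inter> ?U (\<Sqinter>\<^bsub>L\<^esub> A) \<noteq> {}" using C_maps InfA by blast
    moreover have "C \<inter> ?U l \<noteq> {}" using insert.prems C_maps by blast
    ultimately have "C \<inter> (?U l \<inter> ?U (\<Sqinter>\<^bsub>L\<^esub> A)) \<noteq> {}"
      using insert.prems by (intro irreducible_closed_in_Int[OF C] op A) auto
    then show ?case using InfA by blast
  qed
  show "?q (\<Sqinter>\<^bsub>L\<^esub> A) = (\<forall>l \<in> A. ?q l)" if A: "A \<subseteq> carrier L" "finite A" for A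
  proof -
    have "?q (\<Sqinter>\<^bsub>L\<^esub> A) = (\<exists>p \<in> C. \<forall>l \<in> A. p l)"
      using A frame_map_Inf[OF C_maps A] by simp
    also have "\<dots> = (\<forall>l \<in> A. \<exists>p \<in> C. p l)"
      using common A by blast
    also have "\<dots> = (\<forall>l \<in> A. ?q l)"
      using A by auto
    finally show ?thesis .
  qed
qed simp

text \<open>Specialization is the pointwise order of maps. Together with extensionality this makes the
  space \<open>T\<^sub>0\<close>, hence generic points unique.\<close>

lemma closure_of_frame_map:
  assumes L: "complete_lattice L" and p: "p \<in> frame_maps L"
  shows "frame_map_space L closure_of {p} = {r \<in> frame_maps L. \<forall>l \<in> carrier L. r l \<longrightarrow> p l}"
proof -
  have "(\<forall>U. r \<in> U \<and> openin (frame_map_space L) U \<longrightarrow> (\<exists>y. y \<in> {p} \<and> y \<in> U)) \<longleftrightarrow>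
      (\<forall>l \<in> carrier L. r l \<longrightarrow> p l)" (is "?lhs \<longleftrightarrow> ?rhs")
    if r: "r \<in> frame_maps L" for r
  proof
    assume lhs: ?lhs
    show ?rhs
    proof (intro ballI impI)
      fix l assume "l \<in> carrier L" "r l"
      then show "p l"
        using lhs[rule_format, of "{p \<in> frame_maps L. p l}"] r
        by (auto simp: openin_frame_map_space[OF L])
    qed
  next
    assume rhs: ?rhs
    show ?lhs
    proof (intro allI impI)
      fix U assume U: "r \<in> U \<and> openin (frame_map_space L) U"
      then obtain l where "l \<in> carrier L" "U = {p \<in> frame_maps L. p l}"
        unfolding openin_frame_map_space[OF L] by (elim conjE bexE)
      then show "\<exists>y. y \<in> {p} \<and> y \<in> U" using rhs U p by simp
    qed
  qed
  then show ?thesis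
    unfolding set_eq_iff in_closure_of topspace_frame_map_space[OF L] by blast
qed

lemma sober_frame_map_space:
  assumes L: "complete_lattice L"
  shows "sober_space (frame_map_space L)"
  unfolding sober_space_def
proof (intro allI impI)
  let ?X = "frame_map_space L"
  fix C assume C: "irreducible_closed_in ?X C"
  define q where "q = (\<lambda>l \<in> carrier L. \<exists>p \<in> C. p l)"
  have q: "q \<in> frame_maps L"
    unfolding q_def by (rule frame_map_of_irreducible_closed[OF L C])
  have closed: "closedin ?X C" using C by (simp add: irreducible_closed_in_def)
  then have C_sub: "C \<subseteq> frame_maps L"
    using closedin_subset by (fastforce simp: topspace_frame_map_space[OF L])
  have "openin ?X (frame_maps L - C)"
    using closed by (simp add: closedin_def topspace_frame_map_space[OF L])
  then obtain m where m: "m \<in> carrier L" "frame_maps L - C = {p \<in> frame_maps L. p m}"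
    by (auto simp: openin_frame_map_space[OF L])
  have "C = {r \<in> frame_maps L. \<forall>l \<in> carrier L. r l \<longrightarrow> q l}"
  proof (intro equalityI subsetI)
    fix r assume "r \<in> C"
    then show "r \<in> {r \<in> frame_maps L. \<forall>l \<in> carrier L. r l \<longrightarrow> q l}"
      using C_sub by (auto simp: q_def)
  next
    fix r assume r: "r \<in> {r \<in> frame_maps L. \<forall>l \<in> carrier L. r l \<longrightarrow> q l}"
    have "\<not> q m" using m C_sub by (simp add: q_def) blast
    then have "\<not> r m" using r m(1) by blast
    then show "r \<in> C" using r m(2) by blast
  qed
  then have closure: "?X closure_of {q} = C" by (simp add: closure_of_frame_map[OF L q])
  moreover have "r = q" if "r \<in> frame_maps L" "?X closure_of {r} = C" for r
  proof -
    have "r \<in> ?X closure_of {r}" "q \<in> ?X closure_of {q}"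
      using that(1) q by (simp_all add: closure_of_frame_map[OF L])
    then have "r \<in> ?X closure_of {q}" "q \<in> ?X closure_of {r}"
      unfolding closure that(2) by simp_all
    then have "r l = q l" if "l \<in> carrier L" for l
      unfolding closure_of_frame_map[OF L q] closure_of_frame_map[OF L \<open>r \<in> frame_maps L\<close>]
      using that by blast
    then show ?thesis by (rule frame_maps_eqI[OF that(1) q])
  qed
  ultimately show "\<exists>!x. x \<in> topspace ?X \<and> ?X closure_of {x} = C"
    unfolding topspace_frame_map_space[OF L] using q by (metis (lifting))
qed

section \<open>The lattice of open sets\<close>

lemma lattice_open_sets: "lattice (open_sets X)"
proof -
  interpret partial_order "open_sets X" by unfold_locales (auto simp: open_sets_def)
  show ?thesis
  proof unfold_locales
    fix U V assume "U \<in> carrier (open_sets X)" "V \<in> carrier (open_sets X)"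
    then have "openin X U" "openin X V" by (simp_all add: open_sets_def)
    then have "is_lub (open_sets X) (U \<union> V) {U, V}" "is_glb (open_sets X) (U \<inter> V) {U, V}"
      by (auto simp: open_sets_def least_def greatest_def Upper_def Lower_def)
    then show "\<exists>s. is_lub (open_sets X) s {U, V}" "\<exists>s. is_glb (open_sets X) s {U, V}"
      by blast+
  qed
qed

lemma lattice_isomorphic_if_order_isomorphic:
  assumes "lattice L" "lattice M" and bij: "bij_betw \<phi> (carrier L) (carrier M)"
    and ord: "\<And>x y. x \<in> carrier L \<Longrightarrow> y \<in> carrier L \<Longrightarrow> \<phi> x \<sqsubseteq>\<^bsub>M\<^esub> \<phi> y \<longleftrightarrow> x \<sqsubseteq>\<^bsub>L\<^esub> y"
  shows "lattice_isomorphic L M"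
proof -
  interpret L: lattice L by fact
  interpret M: lattice M by fact
  have mem: "\<phi> x \<in> carrier M" if "x \<in> carrier L" for x
    using bij that by (auto simp: bij_betw_def)
  have surj: "\<exists>z \<in> carrier L. \<phi> z = w" if "w \<in> carrier M" for w
  proof -
    have "w \<in> \<phi> ` carrier L" unfolding bij_betw_imp_surj_on[OF bij] by (rule that)
    then show ?thesis by (rule imageE) (rule bexI, rule sym)
  qed
  have "\<phi> (x \<squnion>\<^bsub>L\<^esub> y) = \<phi> x \<squnion>\<^bsub>M\<^esub> \<phi> y" if xy: "x \<in> carrier L" "y \<in> carrier L" for x y
  proof (rule M.le_antisym)
    obtain z where z: "z \<in> carrier L" "\<phi> z = \<phi> x \<squnion>\<^bsub>M\<^esub> \<phi> y"
      using surj[of "\<phi> x \<squnion>\<^bsub>M\<^esub> \<phi> y"] xy mem by auto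
    have "\<phi> x \<sqsubseteq>\<^bsub>M\<^esub> \<phi> z" "\<phi> y \<sqsubseteq>\<^bsub>M\<^esub> \<phi> z"
      using xy z mem by (simp_all add: M.join_left M.join_right)
    then have "x \<sqsubseteq>\<^bsub>L\<^esub> z" "y \<sqsubseteq>\<^bsub>L\<^esub> z"
      by (simp_all only: ord[OF xy(1) z(1)] ord[OF xy(2) z(1)])
    then have "x \<squnion>\<^bsub>L\<^esub> y \<sqsubseteq>\<^bsub>L\<^esub> z" using xy z(1) by (simp add: L.join_le)
    then have "\<phi> (x \<squnion>\<^bsub>L\<^esub> y) \<sqsubseteq>\<^bsub>M\<^esub> \<phi> z" using xy z(1) by (simp add: ord)
    then show "\<phi> (x \<squnion>\<^bsub>L\<^esub> y) \<sqsubseteq>\<^bsub>M\<^esub> \<phi> x \<squnion>\<^bsub>M\<^esub> \<phi> y" by (simp add: z)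
    show "\<phi> x \<squnion>\<^bsub>M\<^esub> \<phi> y \<sqsubseteq>\<^bsub>M\<^esub> \<phi> (x \<squnion>\<^bsub>L\<^esub> y)"
      using xy mem ord by (simp add: M.join_le L.join_left L.join_right)
  qed (use xy mem in auto)
  moreover have "\<phi> (x \<sqinter>\<^bsub>L\<^esub> y) = \<phi> x \<sqinter>\<^bsub>M\<^esub> \<phi> y" if xy: "x \<in> carrier L" "y \<in> carrier L" for x y
  proof (rule M.le_antisym)
    obtain z where z: "z \<in> carrier L" "\<phi> z = \<phi> x \<sqinter>\<^bsub>M\<^esub> \<phi> y"
      using surj[of "\<phi> x \<sqinter>\<^bsub>M\<^esub> \<phi> y"] xy mem by auto
    have "\<phi> z \<sqsubseteq>\<^bsub>M\<^esub> \<phi> x" "\<phi> z \<sqsubseteq>\<^bsub>M\<^esub> \<phi> y"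
      using xy z mem by (simp_all add: M.meet_left M.meet_right)
    then have "z \<sqsubseteq>\<^bsub>L\<^esub> x" "z \<sqsubseteq>\<^bsub>L\<^esub> y"
      by (simp_all only: ord[OF z(1) xy(1)] ord[OF z(1) xy(2)])
    then have "z \<sqsubseteq>\<^bsub>L\<^esub> x \<sqinter>\<^bsub>L\<^esub> y" using xy z(1) by (simp add: L.meet_le)
    then have "\<phi> z \<sqsubseteq>\<^bsub>M\<^esub> \<phi> (x \<sqinter>\<^bsub>L\<^esub> y)" using xy z(1) by (simp add: ord)
    then show "\<phi> x \<sqinter>\<^bsub>M\<^esub> \<phi> y \<sqsubseteq>\<^bsub>M\<^esub> \<phi> (x \<sqinter>\<^bsub>L\<^esub> y)" by (simp add: z)
    show "\<phi> (x \<sqinter>\<^bsub>L\<^esub> y) \<sqsubseteq>\<^bsub>M\<^esub> \<phi> x \<sqinter>\<^bsub>M\<^esub> \<phi> y"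
      using xy mem ord by (simp add: M.meet_le L.meet_left L.meet_right)
  qed (use xy mem in auto)
  ultimately show ?thesis
    unfolding lattice_isomorphic_def join_pres_def meet_pres_def using assms(1,2) bij by blast
qed

lemma lattice_isomorphic_open_sets_frame_map_space:
  assumes L: "complete_lattice L"
    and separate: "\<And>l m. l \<in> carrier L \<Longrightarrow> m \<in> carrier L \<Longrightarrow> \<not> l \<sqsubseteq>\<^bsub>L\<^esub> m \<Longrightarrow>
      \<exists>p \<in> frame_maps L. p l \<and> \<not> p m"
  shows "lattice_isomorphic (open_sets (frame_map_space L)) L"
proof -
  interpret complete_lattice L by fact
  let ?O = "open_sets (frame_map_space L)"
  let ?U = "\<lambda>l. {p \<in> frame_maps L. p l}"
  have ord: "?U l \<subseteq> ?U m \<longleftrightarrow> l \<sqsubseteq>\<^bsub>L\<^esub> m" if "l \<in> carrier L" "m \<in> carrier L" for l m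
  proof
    assume "l \<sqsubseteq>\<^bsub>L\<^esub> m"
    moreover have "isotone L two p" if "p \<in> ?U l" for p
      using that by (simp add: frame_maps_def sup_maps_def)
    ultimately show "?U l \<subseteq> ?U m"
      using that by (auto simp: isotone_def two_def)
  qed (use separate[OF that] in blast)
  have bij: "bij_betw ?U (carrier L) (carrier ?O)"
  proof (rule bij_betw_imageI)
    show "inj_on ?U (carrier L)"
    proof (rule inj_onI)
      fix l m assume lm: "l \<in> carrier L" "m \<in> carrier L" "?U l = ?U m"
      show "l = m"
        using ord[OF lm(1,2)] ord[OF lm(2,1)] lm by (intro le_antisym) auto
    qed
    show "?U ` carrier L = carrier ?O"
      by (auto simp: open_sets_def openin_frame_map_space[OF L])
  qed
  let ?\<phi> = "inv_into (carrier L) ?U"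
  show ?thesis
  proof (rule lattice_isomorphic_if_order_isomorphic)
    show "lattice ?O" by (rule lattice_open_sets)
    show "lattice L" by (rule lattice_axioms)
    show "bij_betw ?\<phi> (carrier ?O) (carrier L)"
      using bij by (rule bij_betw_inv_into)
    fix V W assume VW: "V \<in> carrier ?O" "W \<in> carrier ?O"
    then have U: "?U (?\<phi> V) = V" "?U (?\<phi> W) = W"
      using bij_betw_inv_into_right[OF bij] by blast+
    have "?\<phi> V \<in> carrier L" "?\<phi> W \<in> carrier L"
      using VW bij_betw_apply[OF bij_betw_inv_into[OF bij]] by blast+
    from ord[OF this] have "?\<phi> V \<sqsubseteq>\<^bsub>L\<^esub> ?\<phi> W \<longleftrightarrow> V \<subseteq> W"
      unfolding U by simp
    then show "?\<phi> V \<sqsubseteq>\<^bsub>L\<^esub> ?\<phi> W \<longleftrightarrow> V \<sqsubseteq>\<^bsub>?O\<^esub> W" by (simp add: open_sets_def)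
  qed
qed

section \<open>Meet-prime elements\<close>

lemma frame_map_of_meet_prime:
  assumes L: "complete_lattice L" and P: "P \<in> carrier L"
    and proper: "\<not> \<Sqinter>\<^bsub>L\<^esub> {} \<sqsubseteq>\<^bsub>L\<^esub> P"
    and prime: "\<And>a b. a \<in> carrier L \<Longrightarrow> b \<in> carrier L \<Longrightarrow> a \<sqinter>\<^bsub>L\<^esub> b \<sqsubseteq>\<^bsub>L\<^esub> P \<Longrightarrow>
      a \<sqsubseteq>\<^bsub>L\<^esub> P \<or> b \<sqsubseteq>\<^bsub>L\<^esub> P"
  shows "(\<lambda>l \<in> carrier L. \<not> l \<sqsubseteq>\<^bsub>L\<^esub> P) \<in> frame_maps L" (is "?p \<in> _")
proof (rule frame_mapI[OF L])
  interpret complete_lattice L by fact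
  show "?p (\<Squnion>\<^bsub>L\<^esub> A) = (\<exists>l \<in> A. ?p l)" if A: "A \<subseteq> carrier L" for A
  proof -
    have "\<Squnion>\<^bsub>L\<^esub> A \<sqsubseteq>\<^bsub>L\<^esub> P \<longleftrightarrow> (\<forall>l \<in> A. l \<sqsubseteq>\<^bsub>L\<^esub> P)"
    proof
      assume le: "\<Squnion>\<^bsub>L\<^esub> A \<sqsubseteq>\<^bsub>L\<^esub> P"
      show "\<forall>l \<in> A. l \<sqsubseteq>\<^bsub>L\<^esub> P"
      proof
        fix l assume "l \<in> A"
        then have "l \<sqsubseteq>\<^bsub>L\<^esub> \<Squnion>\<^bsub>L\<^esub> A" "l \<in> carrier L" using A by (auto intro: sup_upper)
        then show "l \<sqsubseteq>\<^bsub>L\<^esub> P" using le_trans[OF _ le] A P by simp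
      qed
    next
      assume "\<forall>l \<in> A. l \<sqsubseteq>\<^bsub>L\<^esub> P"
      then show "\<Squnion>\<^bsub>L\<^esub> A \<sqsubseteq>\<^bsub>L\<^esub> P" using A P by (intro sup_least) auto
    qed
    then show ?thesis using A by auto
  qed
  have below: "\<exists>l \<in> A. l \<sqsubseteq>\<^bsub>L\<^esub> P"
    if "finite A" "A \<subseteq> carrier L" "\<Sqinter>\<^bsub>L\<^esub> A \<sqsubseteq>\<^bsub>L\<^esub> P" for A
    using that
  proof (induction A rule: finite_induct)
    case empty
    then show ?case using proper by simp
  next
    case (insert a A)
    let ?m = "a \<sqinter>\<^bsub>L\<^esub> \<Sqinter>\<^bsub>L\<^esub> A"
    have a: "a \<in> carrier L" and A: "A \<subseteq> carrier L" using insert.prems by auto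
    have "?m \<sqsubseteq>\<^bsub>L\<^esub> \<Sqinter>\<^bsub>L\<^esub> (insert a A)"
    proof (rule inf_greatest)
      fix x assume x: "x \<in> insert a A"
      show "?m \<sqsubseteq>\<^bsub>L\<^esub> x"
      proof (cases "x = a")
        case True
        then show ?thesis using a A by (simp add: meet_left)
      next
        case False
        then have "x \<in> A" using x by simp
        then have "\<Sqinter>\<^bsub>L\<^esub> A \<sqsubseteq>\<^bsub>L\<^esub> x" "x \<in> carrier L" using A inf_lower by auto
        then show ?thesis using le_trans[OF meet_right] a A by simp
      qed
    qed (use a A in auto)
    then have "?m \<sqsubseteq>\<^bsub>L\<^esub> P"
      using insert.prems a A P le_trans[of ?m "\<Sqinter>\<^bsub>L\<^esub> (insert a A)" P] by simp
    then show ?case using prime[of a "\<Sqinter>\<^bsub>L\<^esub> A"] a A insert.IH by auto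
  qed
  show "?p (\<Sqinter>\<^bsub>L\<^esub> A) = (\<forall>l \<in> A. ?p l)" if A: "A \<subseteq> carrier L" "finite A" for A
  proof -
    have "\<Sqinter>\<^bsub>L\<^esub> A \<sqsubseteq>\<^bsub>L\<^esub> P \<longleftrightarrow> (\<exists>l \<in> A. l \<sqsubseteq>\<^bsub>L\<^esub> P)"
    proof
      assume "\<exists>l \<in> A. l \<sqsubseteq>\<^bsub>L\<^esub> P"
      then obtain l where l: "l \<in> A" "l \<sqsubseteq>\<^bsub>L\<^esub> P" by (rule bexE)
      then have "\<Sqinter>\<^bsub>L\<^esub> A \<sqsubseteq>\<^bsub>L\<^esub> l" "l \<in> carrier L" using A inf_lower by auto
      then show "\<Sqinter>\<^bsub>L\<^esub> A \<sqsubseteq>\<^bsub>L\<^esub> P" using le_trans[OF _ l(2)] A P by simp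
    next
      assume "\<Sqinter>\<^bsub>L\<^esub> A \<sqsubseteq>\<^bsub>L\<^esub> P"
      then show "\<exists>l \<in> A. l \<sqsubseteq>\<^bsub>L\<^esub> P" by (rule below[OF A(2,1)])
    qed
    then show ?thesis using A by auto
  qed
qed simp

text \<open>If neither \<open>a\<close> nor \<open>b\<close> lies below \<open>P\<close>, then \<open>c\<close> lies below both \<open>P \<squnion> a\<close> and \<open>P \<squnion> b\<close>.
  Distributivity bounds the meet of these by \<open>P \<squnion> (a \<sqinter> b)\<close>, which would be \<open>P\<close> if \<open>a \<sqinter> b\<close> were
  below \<open>P\<close>.\<close>

lemma distributive_meet_prime:
  assumes dist: "distributive L" and P: "P \<in> carrier L" and c: "c \<in> carrier L"
    and not_le: "\<not> c \<sqsubseteq>\<^bsub>L\<^esub> P"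
    and above: "\<And>Q. Q \<in> carrier L \<Longrightarrow> P \<sqsubseteq>\<^bsub>L\<^esub> Q \<Longrightarrow> Q \<noteq> P \<Longrightarrow> c \<sqsubseteq>\<^bsub>L\<^esub> Q"
    and a: "a \<in> carrier L" and b: "b \<in> carrier L" and le: "a \<sqinter>\<^bsub>L\<^esub> b \<sqsubseteq>\<^bsub>L\<^esub> P"
  shows "a \<sqsubseteq>\<^bsub>L\<^esub> P \<or> b \<sqsubseteq>\<^bsub>L\<^esub> P"
proof (rule ccontr)
  interpret lattice L using dist by (simp add: distributive_def)
  have distrib: "x \<sqinter>\<^bsub>L\<^esub> (y \<squnion>\<^bsub>L\<^esub> z) = (x \<sqinter>\<^bsub>L\<^esub> y) \<squnion>\<^bsub>L\<^esub> (x \<sqinter>\<^bsub>L\<^esub> z)"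
    if "x \<in> carrier L" "y \<in> carrier L" "z \<in> carrier L" for x y z
    using dist that by (simp add: distributive_def)
  assume contr: "\<not> (a \<sqsubseteq>\<^bsub>L\<^esub> P \<or> b \<sqsubseteq>\<^bsub>L\<^esub> P)"
  have c_le: "c \<sqsubseteq>\<^bsub>L\<^esub> P \<squnion>\<^bsub>L\<^esub> d" if "d \<in> carrier L" "\<not> d \<sqsubseteq>\<^bsub>L\<^esub> P" for d
  proof (rule above)
    show "P \<squnion>\<^bsub>L\<^esub> d \<noteq> P" using join_right[of P d] that P by auto
  qed (use that P in \<open>auto simp: join_left\<close>)
  let ?A = "P \<squnion>\<^bsub>L\<^esub> a"
  have A: "?A \<in> carrier L" using P a by simp
  have "c \<sqsubseteq>\<^bsub>L\<^esub> ?A \<sqinter>\<^bsub>L\<^esub> (P \<squnion>\<^bsub>L\<^esub> b)"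
    using contr c_le a b c P by (intro meet_le) auto
  also have "\<dots> = (?A \<sqinter>\<^bsub>L\<^esub> P) \<squnion>\<^bsub>L\<^esub> (?A \<sqinter>\<^bsub>L\<^esub> b)"
    by (rule distrib[OF A P b])
  finally have c_le': "c \<sqsubseteq>\<^bsub>L\<^esub> (?A \<sqinter>\<^bsub>L\<^esub> P) \<squnion>\<^bsub>L\<^esub> (?A \<sqinter>\<^bsub>L\<^esub> b)" .
  have "?A \<sqinter>\<^bsub>L\<^esub> b = b \<sqinter>\<^bsub>L\<^esub> ?A" by (simp add: meet_comm)
  also have "\<dots> = (b \<sqinter>\<^bsub>L\<^esub> P) \<squnion>\<^bsub>L\<^esub> (b \<sqinter>\<^bsub>L\<^esub> a)"
    by (rule distrib[OF b P a])
  also have "\<dots> \<sqsubseteq>\<^bsub>L\<^esub> P"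
    using a b P le by (intro join_le) (auto simp: meet_right meet_comm[of L b a])
  finally have "?A \<sqinter>\<^bsub>L\<^esub> b \<sqsubseteq>\<^bsub>L\<^esub> P" .
  then have "(?A \<sqinter>\<^bsub>L\<^esub> P) \<squnion>\<^bsub>L\<^esub> (?A \<sqinter>\<^bsub>L\<^esub> b) \<sqsubseteq>\<^bsub>L\<^esub> P"
    using A P b by (intro join_le) (auto simp: meet_right)
  then have "c \<sqsubseteq>\<^bsub>L\<^esub> P" using c_le' le_trans A P b c by (meson join_closed meet_closed)
  then show False using not_le by simp
qed

section \<open>Separating thick subcategories\<close>

text \<open>The closure conditions have at most two objects as premises, and two members of the union of
  a chain lie in one member of the chain.\<close>

lemma thick_Union_chain:
  assumes chain: "subset.chain {T. thick K T} \<C>" and "\<C> \<noteq> {}"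
  shows "thick K (\<Union>\<C>)"
  unfolding thick_def
proof (intro conjI allI ballI impI)
  have thick: "thick K T" if "T \<in> \<C>" for T
    using chain that by (auto simp: subset.chain_def)
  have total: "S \<subseteq> T \<or> T \<subseteq> S" if "S \<in> \<C>" "T \<in> \<C>" for S T
    using chain that by (auto simp: subset_chain_def)
  show "\<Union>\<C> \<subseteq> Obj K" using thick_subset[OF thick] by blast
  show "z \<in> \<Union>\<C>" if "is_zero_object K z" for z
    using thick_zero[OF thick] that \<open>\<C> \<noteq> {}\<close> by blast
  show "y \<in> \<Union>\<C>" if "x \<in> \<Union>\<C>" "y \<in> Obj K" "isomorphic K x y" for x y
    using thick_iso[OF thick] that by blast
  show "x \<in> \<Union>\<C> \<longleftrightarrow> susp_obj K x \<in> \<Union>\<C>" if "x \<in> Obj K" for x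
    using thick_susp[OF thick] that by blast
  show "z \<in> \<Union>\<C>" if xy: "x \<in> \<Union>\<C>" "y \<in> \<Union>\<C>" and t: "dist_triangle K x y z t" for x y z t
  proof -
    obtain T where "T \<in> \<C>" "x \<in> T" "y \<in> T" using xy total by blast
    then show ?thesis using thick_cone[OF thick] t by blast
  qed
  show "x \<in> \<Union>\<C>" if "s \<in> \<Union>\<C>" "x \<in> Obj K" "y \<in> Obj K" "is_direct_sum K x y s" for s x y
    using thick_summand[OF thick] that by blast
qed

lemma maximal_thick_avoiding:
  assumes "thick K B" "x \<notin> B"
  obtains P where "thick K P" "B \<subseteq> P" "x \<notin> P"
    "\<And>Q. thick K Q \<Longrightarrow> P \<subseteq> Q \<Longrightarrow> Q \<noteq> P \<Longrightarrow> x \<in> Q"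
proof -
  let ?S = "{T. thick K T \<and> B \<subseteq> T \<and> x \<notin> T}"
  have "\<exists>P \<in> ?S. \<forall>Q \<in> ?S. P \<subseteq> Q \<longrightarrow> Q = P"
  proof (rule subset_Zorn_nonempty)
    show "?S \<noteq> {}" using assms by blast
    fix \<C> assume \<C>: "\<C> \<noteq> {}" "subset.chain ?S \<C>"
    then have "subset.chain {T. thick K T} \<C>" by (auto simp: subset.chain_def)
    then have "thick K (\<Union>\<C>)" using \<C>(1) by (rule thick_Union_chain)
    moreover have "\<C> \<subseteq> ?S" using \<C>(2) by (auto simp: subset.chain_def)
    ultimately show "\<Union>\<C> \<in> ?S" using \<C>(1) by blast
  qed
  then obtain P where P: "P \<in> ?S" and max: "\<forall>Q \<in> ?S. P \<subseteq> Q \<longrightarrow> Q = P" by (rule bexE)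
  show ?thesis
  proof (rule that)
    show "thick K P" "B \<subseteq> P" "x \<notin> P" using P by simp_all
    show "x \<in> Q" if "thick K Q" "P \<subseteq> Q" "Q \<noteq> P" for Q
    proof (rule ccontr)
      assume "x \<notin> Q"
      then have "Q \<in> ?S" using that P by auto
      then show False using max that by simp
    qed
  qed
qed

lemma frame_map_separating_thick:
  assumes K: "triangulated_category K" and dist: "distributive (Thick K)"
    and A: "thick K A" and B: "thick K B" and "\<not> A \<subseteq> B"
  shows "\<exists>p \<in> frame_maps (Thick K). p A \<and> \<not> p B"
proof -
  obtain x where x: "x \<in> A" "x \<notin> B" using assms(5) by blast
  obtain P where P: "thick K P" "B \<subseteq> P" "x \<notin> P"
    and max: "\<And>Q. thick K Q \<Longrightarrow> P \<subseteq> Q \<Longrightarrow> Q \<noteq> P \<Longrightarrow> x \<in> Q"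
    using maximal_thick_avoiding[OF B x(2)] by blast
  \<comment> \<open>The thick subcategory generated by \<open>x\<close>, so that containing \<open>x\<close> becomes an order condition.\<close>
  let ?c = "\<Inter>{T. thick K T \<and> x \<in> T}"
  have c: "thick K ?c" using A x by (intro thick_Inter) auto
  let ?p = "\<lambda>T \<in> carrier (Thick K). \<not> T \<sqsubseteq>\<^bsub>Thick K\<^esub> P"
  have "?p \<in> frame_maps (Thick K)"
  proof (rule frame_map_of_meet_prime[OF complete_lattice_Thick[OF K]])
    show "P \<in> carrier (Thick K)" using P by (simp add: Thick_def)
    have "x \<in> Obj K" using x thick_subset[OF A] by blast
    then show "\<not> \<Sqinter>\<^bsub>Thick K\<^esub> {} \<sqsubseteq>\<^bsub>Thick K\<^esub> P"
      unfolding Inf_Thick[OF K empty_subsetI] using P by (auto simp: Thick_def)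
    fix a b
    assume ab: "a \<in> carrier (Thick K)" "b \<in> carrier (Thick K)"
      "a \<sqinter>\<^bsub>Thick K\<^esub> b \<sqsubseteq>\<^bsub>Thick K\<^esub> P"
    show "a \<sqsubseteq>\<^bsub>Thick K\<^esub> P \<or> b \<sqsubseteq>\<^bsub>Thick K\<^esub> P"
    proof (rule distributive_meet_prime[OF dist _ _ _ _ ab])
      show "P \<in> carrier (Thick K)" "?c \<in> carrier (Thick K)"
        using P c by (simp_all add: Thick_def)
      show "\<not> ?c \<sqsubseteq>\<^bsub>Thick K\<^esub> P" using P by (auto simp: Thick_def)
      show "?c \<sqsubseteq>\<^bsub>Thick K\<^esub> Q"
        if "Q \<in> carrier (Thick K)" "P \<sqsubseteq>\<^bsub>Thick K\<^esub> Q" "Q \<noteq> P" for Q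
        using max[of Q] that by (auto simp: Thick_def)
    qed
  qed
  moreover have "?p A" "\<not> ?p B" using A B P x by (auto simp: Thick_def)
  ultimately show ?thesis by blast
qed

section \<open>The comparison map\<close>

lemma continuous_map_frame_map_space_sup_map_space:
  assumes L: "complete_lattice L"
  shows "continuous_map (frame_map_space L) (sup_map_space L) (\<lambda>p. p)"
  unfolding sup_map_space_def
proof (rule continuous_map_into_topology_subbase)
  fix p assume "p \<in> topspace (frame_map_space L)"
  then show "p \<in> topspace (topology (arbitrary union_of
     (finite intersection_of (\<lambda>U. \<exists>l \<in> carrier L. U = {p \<in> sup_maps L. p l})
       relative_to sup_maps L)))"
    by (simp add: topspace_frame_map_space[OF L] frame_maps_def)
next
  fix U assume "\<exists>l \<in> carrier L. U = {p \<in> sup_maps L. p l}"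
  then obtain l where l: "l \<in> carrier L" "U = {p \<in> sup_maps L. p l}" by blast
  then have "{p \<in> topspace (frame_map_space L). p \<in> U} = {p \<in> frame_maps L. p l}"
    by (auto simp: topspace_frame_map_space[OF L] frame_maps_def)
  then show "openin (frame_map_space L) {p \<in> topspace (frame_map_space L). p \<in> U}"
    using l by (auto simp: openin_frame_map_space[OF L])
qed

theorem mainTheorem4:
  fixes K :: "('o, 'm) triangulated_data"
  assumes "triangulated_category K"
  shows "sober_space (Spcnt K) \<and>
    (distributive (Thick K) \<longrightarrow> lattice_isomorphic (open_sets (Spcnt K)) (Thick K)) \<and>
    continuous_map (Spcnt K) (fSpcnt K) (\<lambda>p. p)"
proof (intro conjI impI)
  note L = complete_lattice_Thick[OF assms]
  show "sober_space (Spcnt K)"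
    unfolding Spcnt_def by (rule sober_frame_map_space[OF L])
  show "lattice_isomorphic (open_sets (Spcnt K)) (Thick K)" if "distributive (Thick K)"
    unfolding Spcnt_def
  proof (rule lattice_isomorphic_open_sets_frame_map_space[OF L])
    fix A B
    assume "A \<in> carrier (Thick K)" "B \<in> carrier (Thick K)" "\<not> A \<sqsubseteq>\<^bsub>Thick K\<^esub> B"
    then show "\<exists>p \<in> frame_maps (Thick K). p A \<and> \<not> p B"
      by (intro frame_map_separating_thick[OF assms that]) (auto simp: Thick_def)
  qed
  show "continuous_map (Spcnt K) (fSpcnt K) (\<lambda>p. p)"
    unfolding Spcnt_def fSpcnt_def by (rule continuous_map_frame_map_space_sup_map_space[OF L])
qed

end
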